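(* Let $\preceq$ be a partial order on a finite index set $\mathcal{I}$ with $n$ elements, let $G=(V,E)$ be a directed graph corresponding to $\preceq$, with $m$ edges, and let $D\in\mathbb{R}^{m\times n}$ be its oriented incidence matrix. Let $\lambda_F,\lambda_{NI}\ge 0$ and let $\bm{y}\in\mathbb{R}^n$ be a fixed vector indexed by $\mathcal{I}$. Then the solution $\hat{\bm{\beta}}^{FNI}(\bm{y},\lambda_F,\lambda_{NI})$ of the fused nearly-isotonic problem $$\hat{\bm{\beta}}^{FNI}(\bm{y},\lambda_F,\lambda_{NI})=\underset{\bm{\beta}\in\mathbb{R}^n}{\arg\min}\ \tfrac12\|\bm{y}-\bm{\beta}\|_2^2+\lambda_F\|D\bm{\beta}\|_1+\lambda_{NI}\|D\bm{\beta}\|_+$$ is given by $$\hat{\bm{\beta}}^{FNI}(\bm{y},\lambda_F,\lambda_{NI})=\bm{y}-D^{T}\hat{\bm{\nu}}(\bm{y},\lambda_F,\lambda_{NI}),$$ where $\hat{\bm{\nu}}(\bm{y},\lambda_F,\lambda_{NI})$ is a solution of $$\underset{\bm{\nu}\in\mathbb{R}^{m}}{\arg\min}\ \tfrac12\|\bm{y}-D^{T}\bm{\nu}\|_2^2\quad\text{subject to}\quad -\lambda_F\bm{1}\le\bm{\nu}\le(\lambda_F+\lambda_{NI})\bm{1}.$$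
   Context: A vector $\bm{\beta}\in\mathbb{R}^n$ indexed by $\mathcal{I}$ is isotonic with respect to $\preceq$ if $\bm{j}_1\preceq\bm{j}_2$ implies $\beta_{\bm{j}_1}\le\beta_{\bm{j}_2}$. A directed graph $G=(V,E)$ corresponds to $\preceq$ if $V=\mathcal{I}$, $E$ is a set of ordered pairs of distinct elements of $\mathcal{I}$, and a vector $\bm{\beta}\in\mathbb{R}^n$ is isotonic with respect to $\preceq$ if and only if $\beta_{\bm{j}_1}\le\beta_{\bm{j}_2}$ for every $(\bm{j}_1,\bm{j}_2)\in E$. Label the vertices by $1,\dots,n$ and the edges by $1,\dots,m$. The oriented incidence matrix $D$ is the $m\times n$ matrix with $D_{i,j}=1$ if vertex $j$ is the source of edge $i$, $D_{i,j}=-1$ if vertex $j$ is the target of edge $i$, and $D_{i,j}=0$ otherwise (an edge $(\bm{i},\bm{j})$ has source $\bm{i}$ and target $\bm{j}$). Notation: $x_+=x\cdot 1\{x>0\}$ for $x\in\mathbb{R}$; $\|\bm{z}\|_+=\sum_i (z_i)_+$; $\|\bm{z}\|_1=\sum_i|z_i|$. Thus $\|D\bm{\beta}\|_1=\sum_{(\bm{i},\bm{j})\in E}|\beta_{\bm{i}}-\beta_{\bm{j}}|$ and $\|D\bm{\beta}\|_+=\sum_{(\bm{i},\bm{j})\in E}(\beta_{\bm{i}}-\beta_{\bm{j}})_+$. $\bm{1}\in\mathbb{R}^m$ is the all-ones vector, and $\bm{a}\le\bm{b}$ for vectors is meant coordinatewise. *)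

theory Defs
  imports
    "HOL-Analysis.L2_Norm"
    "Graph_Theory.Pair_Digraph"
    "Jordan_Normal_Form.Matrix"
begin

text \<open>A vector indexed by \<open>I\<close> is a function of which only the values on \<open>I\<close> matter; the order
  \<open>r\<close> is a set of pairs, \<open>(j1, j2) \<in> r\<close> meaning that \<open>j1\<close> precedes or equals \<open>j2\<close>.\<close>

definition isotonic :: "'a set \<Rightarrow> 'a rel \<Rightarrow> ('a \<Rightarrow> real) \<Rightarrow> bool" where
  "isotonic I r \<beta> \<longleftrightarrow> (\<forall>j1\<in>I. \<forall>j2\<in>I. (j1, j2) \<in> r \<longrightarrow> \<beta> j1 \<le> \<beta> j2)"

text \<open>\<^const>\<open>pair_digraph\<close> demands finitely many vertices, and arcs that join distinct vertices.\<close>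

definition corresponds_to :: "'a pair_pre_digraph \<Rightarrow> 'a set \<Rightarrow> 'a rel \<Rightarrow> bool" where
  "corresponds_to G I r \<longleftrightarrow>
     pair_digraph G \<and> pverts G = I \<and>
     (\<forall>\<beta> :: 'a \<Rightarrow> real. isotonic I r \<beta> \<longleftrightarrow> (\<forall>(j1, j2)\<in>parcs G. \<beta> j1 \<le> \<beta> j2))"

text \<open>Vertices are labelled \<open>v 0, \<dots>, v (n - 1)\<close> and edges \<open>e 0, \<dots>, e (m - 1)\<close>, so entry \<open>j\<close> of a
  vector in \<open>carrier_vec n\<close> is its component at the vertex \<open>v j\<close>. Matrices with carriers are used
  because \<open>m = 0\<close> (a graph without edges) must be allowed.\<close>

definition incidence_mat ::
    "nat \<Rightarrow> nat \<Rightarrow> (nat \<Rightarrow> 'a) \<Rightarrow> (nat \<Rightarrow> 'a \<times> 'a) \<Rightarrow> real mat" where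
  "incidence_mat n m v e =
     mat m n (\<lambda>(i, j). if v j = fst (e i) then 1 else if v j = snd (e i) then - 1 else 0)"

definition pos_part :: "real \<Rightarrow> real" where
  "pos_part x = x * of_bool (x > 0)"

definition norm_plus :: "real vec \<Rightarrow> real" where
  "norm_plus z = (\<Sum>i<dim_vec z. pos_part (z $ i))"

definition norm_1 :: "real vec \<Rightarrow> real" where
  "norm_1 z = (\<Sum>i<dim_vec z. \<bar>z $ i\<bar>)"

definition norm_2 :: "real vec \<Rightarrow> real" where
  "norm_2 z = L2_set (\<lambda>i. z $ i) {..<dim_vec z}"

definition ones_vec :: "nat \<Rightarrow> real vec" where
  "ones_vec m = vec m (\<lambda>_. 1)"

definition fni_objective :: "real mat \<Rightarrow> real vec \<Rightarrow> real \<Rightarrow> real \<Rightarrow> real vec \<Rightarrow> real" where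
  "fni_objective D y lam_F lam_NI \<beta> =
     1/2 * (norm_2 (y - \<beta>))\<^sup>2 + lam_F * norm_1 (D *\<^sub>v \<beta>) + lam_NI * norm_plus (D *\<^sub>v \<beta>)"

definition fni_minimizer :: "real mat \<Rightarrow> real vec \<Rightarrow> real \<Rightarrow> real \<Rightarrow> real vec \<Rightarrow> bool" where
  "fni_minimizer D y lam_F lam_NI = is_arg_min (fni_objective D y lam_F lam_NI) (\<lambda>\<beta>. \<beta> \<in> carrier_vec (dim_col D))"

text \<open>\<^const>\<open>arg_min\<close> picks an arbitrary minimizer, and is unspecified if there is none.\<close>

definition fni_estimator :: "real mat \<Rightarrow> real vec \<Rightarrow> real \<Rightarrow> real \<Rightarrow> real vec" where
  "fni_estimator D y lam_F lam_NI = arg_min (fni_objective D y lam_F lam_NI) (\<lambda>\<beta>. \<beta> \<in> carrier_vec (dim_col D))"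

definition dual_minimizer :: "real mat \<Rightarrow> real vec \<Rightarrow> real \<Rightarrow> real \<Rightarrow> real vec \<Rightarrow> bool" where
  "dual_minimizer D y lam_F lam_NI =
     is_arg_min (\<lambda>\<nu>. 1/2 * (norm_2 (y - D\<^sup>T *\<^sub>v \<nu>))\<^sup>2)
       (\<lambda>\<nu>. \<nu> \<in> carrier_vec (dim_row D) \<and>
            (- lam_F) \<cdot>\<^sub>v ones_vec (dim_row D) \<le> \<nu> \<and> \<nu> \<le> (lam_F + lam_NI) \<cdot>\<^sub>v ones_vec (dim_row D))"

end

theory Submission
  imports Defs "HOL-Analysis.Function_Topology"
begin

text \<open>The penalty is a support function: with \<open>B\<close> the box of all \<open>\<nu>\<close> whose entries lie between
  \<open>- \<lambda>\<^sub>F\<close> and \<open>\<lambda>\<^sub>F + \<lambda>\<^sub>N\<^sub>I\<close>, the value \<open>\<lambda>\<^sub>F \<parallel>z\<parallel>\<^sub>1 + \<lambda>\<^sub>N\<^sub>I \<parallel>z\<parallel>\<^sub>+\<close> is the maximum of \<open>\<nu> \<bullet> z\<close> over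
  \<open>\<nu> \<in> B\<close> (\<open>pairing_le_fused_penalty\<close>, \<open>fused_penalty_attained\<close>). The dual problem projects \<open>y\<close> onto
  the compact convex set \<open>D\<^sup>T B\<close>. It has a solution \<open>\<nu>\<close> by compactness, and the variational
  inequality for the residual \<open>\<beta> = y - D\<^sup>T \<nu>\<close> of a projection says that \<open>\<nu>\<close> maximizes
  \<open>\<nu>' \<bullet> D \<beta>\<close> over \<open>\<nu>' \<in> B\<close>; hence \<open>\<nu> \<bullet> D \<beta>\<close> equals the penalty at \<open>D \<beta>\<close>
  (\<open>dual_minimizer_pairing\<close>). For any competitor \<open>\<gamma>\<close> the penalty at \<open>D \<gamma>\<close> is at least
  \<open>\<nu> \<bullet> D \<gamma> = (y - \<beta>) \<bullet> \<gamma>\<close>, and completing the square shows that the objective at \<open>\<gamma>\<close> exceeds the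
  objective at \<open>\<beta>\<close> by at least \<open>\<parallel>\<gamma> - \<beta>\<parallel>\<^sup>2 / 2\<close> (\<open>fni_objective_growth\<close>). So \<open>\<beta>\<close> is the unique
  minimizer, whichever dual solution \<open>\<nu>\<close> it came from.\<close>

section \<open>The penalty as a support function\<close>

lemma norm_2_square: "(norm_2 z)\<^sup>2 = z \<bullet> z"
  by (simp add: norm_2_def L2_set_def scalar_prod_def sum_nonneg power2_eq_square
      atLeast0LessThan)

definition fused_penalty :: "real \<Rightarrow> real \<Rightarrow> real vec \<Rightarrow> real" where
  "fused_penalty lam_F lam_NI z = lam_F * norm_1 z + lam_NI * norm_plus z"

definition dual_box :: "nat \<Rightarrow> real \<Rightarrow> real \<Rightarrow> real vec set" where
  "dual_box m lam_F lam_NI =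
     {\<nu> \<in> carrier_vec m. \<forall>i<m. - lam_F \<le> \<nu> $ i \<and> \<nu> $ i \<le> lam_F + lam_NI}"

lemma fused_penalty_eq_sum:
  "fused_penalty lam_F lam_NI z = (\<Sum>i<dim_vec z. lam_F * \<bar>z $ i\<bar> + lam_NI * pos_part (z $ i))"
  by (simp add: fused_penalty_def norm_1_def norm_plus_def sum.distrib sum_distrib_left)

lemma pairing_le_fused_penalty:
  assumes \<nu>: "\<nu> \<in> dual_box m lam_F lam_NI" and z: "z \<in> carrier_vec m"
  shows "\<nu> \<bullet> z \<le> fused_penalty lam_F lam_NI z"
proof -
  have "\<nu> $ i * z $ i \<le> lam_F * \<bar>z $ i\<bar> + lam_NI * pos_part (z $ i)" if "i < m" for i
  proof (cases "z $ i > 0")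
    case True
    then have "\<nu> $ i * z $ i \<le> (lam_F + lam_NI) * z $ i"
      using \<nu> that by (intro mult_right_mono) (auto simp: dual_box_def)
    then show ?thesis
      using True by (simp add: pos_part_def algebra_simps)
  next
    case False
    then have "\<nu> $ i * z $ i \<le> - lam_F * z $ i"
      using \<nu> that by (intro mult_right_mono_neg) (auto simp: dual_box_def)
    then show ?thesis
      using False by (simp add: pos_part_def)
  qed
  then show ?thesis
    using z by (auto simp: fused_penalty_eq_sum scalar_prod_def atLeast0LessThan intro!: sum_mono)
qed

lemma fused_penalty_attained:
  assumes "lam_F \<ge> 0" "lam_NI \<ge> 0" and z: "z \<in> carrier_vec m"
  shows "\<exists>\<nu> \<in> dual_box m lam_F lam_NI. \<nu> \<bullet> z = fused_penalty lam_F lam_NI z"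
proof
  \<comment> \<open>the corner of the box selected by the signs of the entries of \<open>z\<close>\<close>
  let ?\<nu> = "vec m (\<lambda>i. if z $ i > 0 then lam_F + lam_NI else - lam_F)"
  show "?\<nu> \<in> dual_box m lam_F lam_NI"
    using assms by (auto simp: dual_box_def)
  show "?\<nu> \<bullet> z = fused_penalty lam_F lam_NI z"
    using z by (auto simp: fused_penalty_eq_sum scalar_prod_def atLeast0LessThan pos_part_def
        algebra_simps intro!: sum.cong)
qed

section \<open>The dual problem\<close>

lemma dual_minimizer_iff:
  assumes "D \<in> carrier_mat m n"
  shows "dual_minimizer D y lam_F lam_NI \<nu> \<longleftrightarrow> \<nu> \<in> dual_box m lam_F lam_NI \<and>
    (\<forall>\<mu> \<in> dual_box m lam_F lam_NI.
       (norm_2 (y - D\<^sup>T *\<^sub>v \<nu>))\<^sup>2 \<le> (norm_2 (y - D\<^sup>T *\<^sub>v \<mu>))\<^sup>2)"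
proof -
  have "(\<mu> \<in> carrier_vec m \<and> (- lam_F) \<cdot>\<^sub>v ones_vec m \<le> \<mu> \<and>
      \<mu> \<le> (lam_F + lam_NI) \<cdot>\<^sub>v ones_vec m) \<longleftrightarrow> \<mu> \<in> dual_box m lam_F lam_NI" for \<mu>
    by (auto simp: dual_box_def less_eq_vec_def ones_vec_def)
  then show ?thesis
    using assms by (auto simp: dual_minimizer_def is_arg_min_linorder)
qed

text \<open>A continuous function on a compact set attains its minimum. The box is the image under
  \<open>vec m\<close> of a product of compact intervals, which is compact in the product topology on functions
  (Tychonoff). Coordinates from \<open>m\<close> on do not enter \<open>vec m x\<close>, and any value in the interval
  may fill them when a vector is turned back into a function.\<close>

lemma dual_minimizer_exists:
  assumes D: "D \<in> carrier_mat m n" and y: "y \<in> carrier_vec n"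
    and "lam_F \<ge> 0" "lam_NI \<ge> 0"
  shows "\<exists>\<nu>. dual_minimizer D y lam_F lam_NI \<nu>"
proof -
  define K :: "(nat \<Rightarrow> real) set" where "K = (\<Pi>\<^sub>E i\<in>UNIV. {- lam_F .. lam_F + lam_NI})"
  have "compactin (product_topology (\<lambda>_. euclidean) UNIV) K"
    unfolding K_def by (subst compactin_PiE) auto
  then have K: "compact K"
    by (simp add: euclidean_product_topology)
  have "(\<lambda>_. - lam_F) \<in> K"
    using assms by (auto simp: K_def)
  then have "K \<noteq> {}" by blast
  define obj where "obj x = (norm_2 (y - D\<^sup>T *\<^sub>v vec m x))\<^sup>2" for x :: "nat \<Rightarrow> real"
  have "obj x = (\<Sum>j<n. (y $ j - (\<Sum>i<m. D $$ (i, j) * x i))\<^sup>2)" for x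
    using D y unfolding obj_def norm_2_square
    by (simp add: scalar_prod_def power2_eq_square atLeast0LessThan)
  moreover have "continuous_on K (\<lambda>x. x i)" for i
    by (rule continuous_on_subset[OF continuous_on_product_coordinates]) simp
  ultimately have "continuous_on K obj"
    by (simp add: continuous_intros)
  then obtain x where x: "x \<in> K" "\<And>x'. x' \<in> K \<Longrightarrow> obj x \<le> obj x'"
    using continuous_attains_inf[OF K \<open>K \<noteq> {}\<close>] by blast
  have "(norm_2 (y - D\<^sup>T *\<^sub>v vec m x))\<^sup>2 \<le> (norm_2 (y - D\<^sup>T *\<^sub>v \<mu>))\<^sup>2"
    if \<mu>: "\<mu> \<in> dual_box m lam_F lam_NI" for \<mu>
  proof -
    let ?x' = "\<lambda>i. if i < m then \<mu> $ i else - lam_F"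
    have "?x' \<in> K"
      using \<mu> assms by (auto simp: K_def dual_box_def)
    moreover have "vec m ?x' = \<mu>"
      using \<mu> by (auto simp: dual_box_def)
    ultimately show ?thesis
      using x(2)[of ?x'] by (simp add: obj_def)
  qed
  moreover have "vec m x \<in> dual_box m lam_F lam_NI"
    using x(1) by (auto simp: K_def dual_box_def PiE_iff)
  ultimately show ?thesis
    unfolding dual_minimizer_iff[OF D] by blast
qed

lemma norm_2_diff_square:
  assumes "a \<in> carrier_vec n" "b \<in> carrier_vec n"
  shows "(norm_2 (a - b))\<^sup>2 = (norm_2 a)\<^sup>2 - 2 * (a \<bullet> b) + (norm_2 b)\<^sup>2"
  using assms
  by (simp add: norm_2_square minus_scalar_prod_distrib[of _ n] scalar_prod_minus_distrib[of _ n]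
      comm_scalar_prod[of b n a])

text \<open>The first-order condition at a minimizer: moving \<open>\<nu>\<close> a fraction \<open>t\<close> of the way towards \<open>\<mu>\<close>
  stays in the box and changes the squared residual by \<open>t\<^sup>2 \<parallel>w\<parallel>\<^sup>2 - 2 t (\<beta> \<bullet> w)\<close>, where
  \<open>w = D\<^sup>T (\<mu> - \<nu>)\<close>. Since this is nonnegative for all small \<open>t\<close>, the linear term cannot
  be negative.\<close>

lemma dual_minimizer_variational:
  assumes D: "D \<in> carrier_mat m n" and y: "y \<in> carrier_vec n"
    and \<nu>: "dual_minimizer D y lam_F lam_NI \<nu>" and \<mu>: "\<mu> \<in> dual_box m lam_F lam_NI"
  shows "\<mu> \<bullet> (D *\<^sub>v (y - D\<^sup>T *\<^sub>v \<nu>)) \<le> \<nu> \<bullet> (D *\<^sub>v (y - D\<^sup>T *\<^sub>v \<nu>))"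
proof -
  define \<beta> where "\<beta> = y - D\<^sup>T *\<^sub>v \<nu>"
  define w where "w = D\<^sup>T *\<^sub>v (\<mu> - \<nu>)"
  have \<nu>_box: "\<nu> \<in> dual_box m lam_F lam_NI"
    and min: "\<And>\<eta>. \<eta> \<in> dual_box m lam_F lam_NI \<Longrightarrow> (norm_2 \<beta>)\<^sup>2 \<le> (norm_2 (y - D\<^sup>T *\<^sub>v \<eta>))\<^sup>2"
    using \<nu> unfolding dual_minimizer_iff[OF D] \<beta>_def by auto
  have carr: "\<nu> \<in> carrier_vec m" "\<mu> \<in> carrier_vec m"
    using \<nu>_box \<mu> by (auto simp: dual_box_def)
  then have \<beta>: "\<beta> \<in> carrier_vec n" and w: "w \<in> carrier_vec n"
    using D y by (auto simp: \<beta>_def w_def)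
  have step: "2 * (\<beta> \<bullet> w) \<le> t * (norm_2 w)\<^sup>2" if t: "0 < t" "t \<le> 1" for t
  proof -
    have "\<nu> + t \<cdot>\<^sub>v (\<mu> - \<nu>) \<in> dual_box m lam_F lam_NI"
    proof -
      have "- lam_F \<le> \<nu> $ i + t * (\<mu> $ i - \<nu> $ i) \<and> \<nu> $ i + t * (\<mu> $ i - \<nu> $ i) \<le> lam_F + lam_NI"
        if "i < m" for i
      proof -
        have "\<nu> $ i + t * (\<mu> $ i - \<nu> $ i) = (1 - t) * \<nu> $ i + t * \<mu> $ i"
          by (simp add: algebra_simps)
        moreover have "(1 - t) * \<nu> $ i + t * \<mu> $ i \<le> lam_F + lam_NI"
          using that t \<nu>_box \<mu> by (intro convex_bound_le) (auto simp: dual_box_def)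
        moreover have "(1 - t) * (- \<nu> $ i) + t * (- \<mu> $ i) \<le> lam_F"
          using that t \<nu>_box \<mu> by (intro convex_bound_le) (force simp: dual_box_def)+
        ultimately show ?thesis by simp
      qed
      then show ?thesis using carr by (simp add: dual_box_def)
    qed
    moreover have "y - D\<^sup>T *\<^sub>v (\<nu> + t \<cdot>\<^sub>v (\<mu> - \<nu>)) = \<beta> - t \<cdot>\<^sub>v w"
    proof -
      have "D\<^sup>T *\<^sub>v (\<nu> + t \<cdot>\<^sub>v (\<mu> - \<nu>)) = D\<^sup>T *\<^sub>v \<nu> + t \<cdot>\<^sub>v w"
        using D carr by (simp add: w_def mult_add_distrib_mat_vec[of _ n m] mult_mat_vec[of _ n m])
      then show ?thesis
        using D y carr w by (auto simp: \<beta>_def)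
    qed
    ultimately have "(norm_2 \<beta>)\<^sup>2 \<le> (norm_2 (\<beta> - t \<cdot>\<^sub>v w))\<^sup>2"
      using min by metis
    also have "\<dots> = (norm_2 \<beta>)\<^sup>2 + t * (t * (norm_2 w)\<^sup>2 - 2 * (\<beta> \<bullet> w))"
      using norm_2_diff_square[OF \<beta>, of "t \<cdot>\<^sub>v w"] \<beta> w
      by (simp add: norm_2_square algebra_simps)
    finally have "0 \<le> t * (t * (norm_2 w)\<^sup>2 - 2 * (\<beta> \<bullet> w))" by simp
    then show ?thesis using t by (simp add: zero_le_mult_iff)
  qed
  have "\<beta> \<bullet> w \<le> 0"
  proof -
    have "((\<lambda>t. t * (norm_2 w)\<^sup>2) \<longlongrightarrow> 0 * (norm_2 w)\<^sup>2) (at_right 0)"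
      by (intro tendsto_intros)
    moreover have "\<forall>\<^sub>F t in at_right 0. 2 * (\<beta> \<bullet> w) \<le> t * (norm_2 w)\<^sup>2"
      using eventually_at_right_less[of 0] eventually_at_right_real[of 0 1]
      by (auto elim!: eventually_mono intro: step)
    ultimately have "2 * (\<beta> \<bullet> w) \<le> 0 * (norm_2 w)\<^sup>2"
      by (intro tendsto_lowerbound) auto
    then show ?thesis by simp
  qed
  moreover have "\<beta> \<bullet> w = (\<mu> - \<nu>) \<bullet> (D *\<^sub>v \<beta>)"
    using transpose_vec_mult_scalar[OF D \<beta>, of "\<mu> - \<nu>"] carr comm_scalar_prod[OF \<beta> w]
    by (simp add: w_def)
  moreover have "\<dots> = \<mu> \<bullet> (D *\<^sub>v \<beta>) - \<nu> \<bullet> (D *\<^sub>v \<beta>)"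
    using D carr \<beta> by (intro minus_scalar_prod_distrib[of _ m]) auto
  ultimately show ?thesis by (simp add: \<beta>_def)
qed

text \<open>The variational inequality applied to a \<open>\<mu>\<close> at which the penalty of \<open>D \<beta>\<close> is attained: this is
  complementary slackness, summed over the edges.\<close>

lemma dual_minimizer_pairing:
  assumes D: "D \<in> carrier_mat m n" and y: "y \<in> carrier_vec n"
    and lam: "lam_F \<ge> 0" "lam_NI \<ge> 0"
    and \<nu>: "dual_minimizer D y lam_F lam_NI \<nu>"
  defines "\<beta> \<equiv> y - D\<^sup>T *\<^sub>v \<nu>"
  shows "\<nu> \<bullet> (D *\<^sub>v \<beta>) = fused_penalty lam_F lam_NI (D *\<^sub>v \<beta>)"
proof (rule antisym)
  have D\<beta>: "D *\<^sub>v \<beta> \<in> carrier_vec m"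
    using D by (intro carrier_vecI) simp
  show "\<nu> \<bullet> (D *\<^sub>v \<beta>) \<le> fused_penalty lam_F lam_NI (D *\<^sub>v \<beta>)"
    using \<nu> D\<beta> dual_minimizer_iff[OF D] by (blast intro: pairing_le_fused_penalty)
  show "fused_penalty lam_F lam_NI (D *\<^sub>v \<beta>) \<le> \<nu> \<bullet> (D *\<^sub>v \<beta>)"
    using fused_penalty_attained[OF lam D\<beta>] dual_minimizer_variational[OF D y \<nu>]
    by (fastforce simp: \<beta>_def)
qed

section \<open>From dual to primal solutions\<close>

text \<open>Strong convexity of the objective at its minimizer; the quadratic term on the right gives
  uniqueness. The penalty of \<open>D \<gamma>\<close> is bounded below by the linear function \<open>(y - \<beta>) \<bullet> \<gamma>\<close> of \<open>\<gamma>\<close>,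
  with equality at \<open>\<gamma> = \<beta>\<close>; what remains is the identity
  \<open>\<parallel>y - \<gamma>\<parallel>\<^sup>2 = \<parallel>y - \<beta>\<parallel>\<^sup>2 - 2 (y - \<beta>) \<bullet> (\<gamma> - \<beta>) + \<parallel>\<gamma> - \<beta>\<parallel>\<^sup>2\<close>.\<close>

lemma fni_objective_growth:
  assumes D: "D \<in> carrier_mat m n" and y: "y \<in> carrier_vec n"
    and lam: "lam_F \<ge> 0" "lam_NI \<ge> 0"
    and \<nu>: "dual_minimizer D y lam_F lam_NI \<nu>" and \<gamma>: "\<gamma> \<in> carrier_vec n"
  defines "\<beta> \<equiv> y - D\<^sup>T *\<^sub>v \<nu>"
  shows "fni_objective D y lam_F lam_NI \<beta> + 1/2 * (norm_2 (\<gamma> - \<beta>))\<^sup>2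
    \<le> fni_objective D y lam_F lam_NI \<gamma>"
proof -
  have box: "\<nu> \<in> dual_box m lam_F lam_NI"
    using \<nu> dual_minimizer_iff[OF D] by blast
  then have \<nu>_carr: "\<nu> \<in> carrier_vec m" by (simp add: dual_box_def)
  then have \<beta>: "\<beta> \<in> carrier_vec n" using D y by (simp add: \<beta>_def)
  have res: "y - \<beta> = D\<^sup>T *\<^sub>v \<nu>"
    using D y \<nu>_carr by (auto simp: \<beta>_def)
  have adjoint: "(y - \<beta>) \<bullet> x = \<nu> \<bullet> (D *\<^sub>v x)" if "x \<in> carrier_vec n" for x
    using transpose_vec_mult_scalar[OF D that \<nu>_carr] by (simp add: res)
  have "fused_penalty lam_F lam_NI (D *\<^sub>v \<beta>) = (y - \<beta>) \<bullet> \<beta>"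
    using dual_minimizer_pairing[OF D y lam \<nu>] adjoint[OF \<beta>] by (simp add: \<beta>_def)
  moreover have "(y - \<beta>) \<bullet> \<gamma> \<le> fused_penalty lam_F lam_NI (D *\<^sub>v \<gamma>)"
    using pairing_le_fused_penalty[OF box, of "D *\<^sub>v \<gamma>"] adjoint[OF \<gamma>] mult_mat_vec_carrier[OF D \<gamma>] by simp
  moreover have "(norm_2 (y - \<gamma>))\<^sup>2 =
      (norm_2 (y - \<beta>))\<^sup>2 - 2 * ((y - \<beta>) \<bullet> \<gamma> - (y - \<beta>) \<bullet> \<beta>) + (norm_2 (\<gamma> - \<beta>))\<^sup>2"
    using y \<beta> \<gamma>
    by (simp add: norm_2_square minus_scalar_prod_distrib[of _ n] scalar_prod_minus_distrib[of _ n]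
        comm_scalar_prod[of \<beta> n y] comm_scalar_prod[of \<gamma> n y] comm_scalar_prod[of \<gamma> n \<beta>])
  ultimately show ?thesis
    unfolding fni_objective_def fused_penalty_def by argo
qed

lemma fni_minimizer_iff_dual_residual:
  assumes D: "D \<in> carrier_mat m n" and y: "y \<in> carrier_vec n"
    and lam: "lam_F \<ge> 0" "lam_NI \<ge> 0"
    and \<nu>: "dual_minimizer D y lam_F lam_NI \<nu>"
  shows "fni_minimizer D y lam_F lam_NI \<beta> \<longleftrightarrow> \<beta> = y - D\<^sup>T *\<^sub>v \<nu>"
proof -
  let ?\<beta> = "y - D\<^sup>T *\<^sub>v \<nu>"
  have \<beta>_carr: "?\<beta> \<in> carrier_vec n"
    using D by (intro carrier_vecI) simp
  have dim: "dim_col D = n" using D by simp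
  have growth: "fni_objective D y lam_F lam_NI ?\<beta> + 1/2 * (norm_2 (\<gamma> - ?\<beta>))\<^sup>2
      \<le> fni_objective D y lam_F lam_NI \<gamma>" if "\<gamma> \<in> carrier_vec n" for \<gamma>
    using fni_objective_growth[OF D y lam \<nu> that] .
  show ?thesis
  proof
    assume min: "fni_minimizer D y lam_F lam_NI \<beta>"
    then have \<beta>: "\<beta> \<in> carrier_vec n"
      and "fni_objective D y lam_F lam_NI \<beta> \<le> fni_objective D y lam_F lam_NI ?\<beta>"
      using \<beta>_carr by (auto simp: fni_minimizer_def is_arg_min_linorder dim)
    with growth[OF \<beta>] have "(norm_2 (\<beta> - ?\<beta>))\<^sup>2 \<le> 0" by linarith
    then have "(\<Sum>i<n. ((\<beta> - ?\<beta>) $ i)\<^sup>2) \<le> 0"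
      using D by (simp add: norm_2_def L2_set_def sum_nonneg)
    then have "\<forall>i<n. (\<beta> - ?\<beta>) $ i = 0"
      by (metis (no_types, lifting) finite_lessThan lessThan_iff order_antisym sum_nonneg
          sum_nonneg_eq_0_iff zero_eq_power2 zero_le_power2)
    then show "\<beta> = ?\<beta>"
      using \<beta> \<beta>_carr D by (intro eq_vecI) auto
  next
    assume "\<beta> = ?\<beta>"
    moreover have "fni_objective D y lam_F lam_NI ?\<beta> \<le> fni_objective D y lam_F lam_NI \<gamma>"
      if "\<gamma> \<in> carrier_vec n" for \<gamma>
      using growth[OF that] zero_le_power2[of "norm_2 (\<gamma> - ?\<beta>)"] by linarith
    ultimately show "fni_minimizer D y lam_F lam_NI \<beta>"
      using \<beta>_carr by (simp add: fni_minimizer_def is_arg_min_linorder dim)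
  qed
qed

theorem theorem1:
  fixes I :: "'a set" and r :: "'a rel" and G :: "'a pair_pre_digraph"
    and n m :: nat and v :: "nat \<Rightarrow> 'a" and e :: "nat \<Rightarrow> 'a \<times> 'a"
    and lam_F lam_NI :: real
  assumes "finite I" and "partial_order_on I r"
    and "corresponds_to G I r"
    and "bij_betw v {..<n} I" and "bij_betw e {..<m} (parcs G)"
    and "D = incidence_mat n m v e"
    and "lam_F \<ge> 0" and "lam_NI \<ge> 0"
    and "y \<in> carrier_vec n"
  shows "(\<exists>!\<beta>. fni_minimizer D y lam_F lam_NI \<beta>) \<and>
    (\<exists>\<nu>. dual_minimizer D y lam_F lam_NI \<nu>) \<and>
    (\<forall>\<nu>. dual_minimizer D y lam_F lam_NI \<nu> \<longrightarrow>
       fni_estimator D y lam_F lam_NI = y - D\<^sup>T *\<^sub>v \<nu>)"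
proof -
  have D: "D \<in> carrier_mat m n"
    using assms(6) by (simp add: incidence_mat_def)
  note residual = fni_minimizer_iff_dual_residual[OF D assms(9,7,8)]
  obtain \<nu> where \<nu>: "dual_minimizer D y lam_F lam_NI \<nu>"
    using dual_minimizer_exists[OF D assms(9,7,8)] by blast
  have unique: "\<exists>!\<beta>. fni_minimizer D y lam_F lam_NI \<beta>"
    by (simp add: residual[OF \<nu>])
  have "fni_minimizer D y lam_F lam_NI (fni_estimator D y lam_F lam_NI)"
    using unique unfolding fni_estimator_def arg_min_def fni_minimizer_def by (metis someI_ex)
  then show ?thesis
    using unique \<nu> residual by blast
qed

end
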